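(* Let $\langle p:=\psi\rangle\varphi\in\mathcal{L}_{\mathsf{MISL}}$ be such that both $\langle p:=\psi\rangle\varphi$ and $\varphi$ are clean formulas. Then $\langle p:=\psi\rangle\varphi\leftrightarrow\varphi[\psi/p]$ is valid, i.e. for every Kripke model $M$ and state $w$ of $M$, $M,w\vDash_{\mathsf{MISL}}\langle p:=\psi\rangle\varphi$ if and only if $M,w\vDash_{\mathsf{MISL}}\varphi[\psi/p]$.
   Context: Language and semantics. Let $\mathbf{P}$ be a countable set of propositional letters. $\mathcal{L}_{\mathsf{MISL}}$: $\varphi::=p\mid\neg\varphi\mid\varphi\land\varphi\mid\Diamond\varphi\mid\langle p:=\varphi\rangle\varphi\mid\langle(p:=\varphi)^*\rangle\varphi$, $p\in\mathbf{P}$. We write $\langle p:=\psi_1;q:=\psi_2\rangle\varphi$ for $\langle p:=\psi_1\rangle\langle q:=\psi_2\rangle\varphi$, and likewise $\langle p:=\psi_0;(p:=\psi_1)^*\rangle\varphi$ for $\langle p:=\psi_0\rangle\langle(p:=\psi_1)^*\rangle\varphi$. A (Kripke) model is $M=(W,R,V)$ with $W\neq\emptyset$, $R\subseteq W\times W$, $V:\mathbf{P}\to2^W$. Truth: letters, Booleans and $\Diamond$ as usual; $M,w\vDash\langle p:=\psi\rangle\varphi$ iff $M|_{p:=\psi},w\vDash\varphi$, where $M|_{p:=\psi}$ is $M$ with the value of $p$ changed to $\{v\in W:M,v\vDash\psi\}$; $M,w\vDash\langle(p:=\psi)^*\rangle\varphi$ iff $M|_{(p:=\psi)^n},w\vDash\varphi$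 for some $n\in\mathbb{N}$, where $M|_{(p:=\psi)^0}=M$ and $M|_{(p:=\psi)^{n+1}}=(M|_{(p:=\psi)^n})|_{p:=\psi}$. Normal formulas. An $\mathcal{L}_{\mathsf{MISL}}$-formula is normal if every iterative substitution operator $\langle(p:=\psi)^*\rangle$ in it follows immediately after a single-step operator $\langle p:=\psi_0\rangle$ with the same pivot, i.e. occurs as part of $\langle p:=\psi_0;(p:=\psi)^*\rangle$. Free/bound/clean. $p$ is the pivot of $\langle p:=\psi\rangle$ and of $\langle(p:=\psi)^*\rangle$. The scope of $\langle p:=\psi\rangle$ in $\langle p:=\psi\rangle\varphi$ is $\varphi$; the scope of $\langle(p:=\psi)^*\rangle$ in $\langle(p:=\psi)^*\rangle\varphi$ is the whole formula $\langle(p:=\psi)^*\rangle\varphi$. In a normal formula, an occurrence of a letter $p$ is bound if it is a pivot or lies in the scope of a substitution operator with pivot $p$; otherwise it is free. A formula is clean if it is normal and no letter has both a free and a bound occurrence in it. By convention cleanness of $\varphi$ is also assumed to be inherited: if $\varphi$ is $\langle p:=\psi\rangle\chi$ and the main connective of $\chi$ is not an iterative substitution operator, then $\chi$ and $\psi$ are clean; if $\varphi$ is $\langle p:=\psi_1;(p:=\psi_2)^*\rangle\chi$, then $\psi_1,\psi_2,\chi$ are clean. Replacement (for normal formulas). $p[\psi/p]=\psi$; $q[\psi/p]=q$ for $q\neq p$; $[\psi/p]$ commutes with $\neg,\land,\Diamond$; if the main connective of $\varphi$ is not an iterative substitution operator, $(\langle q:=\chi\rangle\varphi)[\psi/p]$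 is $\langle q:=\chi[\psi/p]\rangle(\varphi[\psi/p])$ if $q\neq p$ and $\langle p:=\chi[\psi/p]\rangle\varphi$ if $q=p$; and $(\langle q:=\chi_0;(q:=\chi_1)^*\rangle\varphi)[\psi/p]$ is $\langle q:=\chi_0[\psi/p];(q:=\chi_1[\psi/p])^*\rangle(\varphi[\psi/p])$ if $q\neq p$ and $\langle p:=\chi_0[\psi/p];(p:=\chi_1)^*\rangle\varphi$ if $q=p$. *)

theory Defs
  imports Main "HOL-Library.Countable"
begin

text \<open>\<open>Assign p \<psi> \<phi>\<close> is \<open>\<langle>p := \<psi>\<rangle>\<phi>\<close> and \<open>Iter p \<psi> \<phi>\<close> is \<open>\<langle>(p := \<psi>)*\<rangle>\<phi>\<close>.\<close>

datatype 'p fm =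
    Letter 'p
  | Neg "'p fm"
  | Conj "'p fm" "'p fm"
  | Dia "'p fm"
  | Assign 'p "'p fm" "'p fm"
  | Iter 'p "'p fm" "'p fm"

record ('w, 'p) kripke =
  worlds :: "'w set"
  rel :: "('w \<times> 'w) set"
  val :: "'p \<Rightarrow> 'w set"

definition kripke_model :: "('w, 'p) kripke \<Rightarrow> bool" where
  "kripke_model M \<longleftrightarrow>
     worlds M \<noteq> {} \<and> rel M \<subseteq> worlds M \<times> worlds M \<and> (\<forall>p. val M p \<subseteq> worlds M)"

primrec holds :: "'p fm \<Rightarrow> ('w, 'p) kripke \<Rightarrow> 'w \<Rightarrow> bool" where
  "holds (Letter p) M w \<longleftrightarrow> w \<in> val M p"
| "holds (Neg \<phi>) M w \<longleftrightarrow> \<not> holds \<phi> M w"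
| "holds (Conj \<phi> \<psi>) M w \<longleftrightarrow> holds \<phi> M w \<and> holds \<psi> M w"
| "holds (Dia \<phi>) M w \<longleftrightarrow> (\<exists>v. (w, v) \<in> rel M \<and> holds \<phi> M v)"
| "holds (Assign p \<psi> \<phi>) M w \<longleftrightarrow>
     holds \<phi> (M\<lparr>val := (val M)(p := {v \<in> worlds M. holds \<psi> M v})\<rparr>) w"
| "holds (Iter p \<psi> \<phi>) M w \<longleftrightarrow>
     (\<exists>n. holds \<phi>
        (((\<lambda>N. N\<lparr>val := (val N)(p := {v \<in> worlds N. holds \<psi> N v})\<rparr>) ^^ n) M) w)"

abbreviation sat :: "('w, 'p) kripke \<Rightarrow> 'w \<Rightarrow> 'p fm \<Rightarrow> bool" ("_, _ \<Turnstile> _" [51, 51, 51] 50) where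
  "M, w \<Turnstile> \<phi> \<equiv> holds \<phi> M w"

text \<open>The model \<open>M\<close> with \<open>p\<close> reset to the truth set of \<open>\<psi>\<close>, and the truth clauses in terms of it.\<close>

definition update :: "'p \<Rightarrow> 'p fm \<Rightarrow> ('w, 'p) kripke \<Rightarrow> ('w, 'p) kripke" where
  "update p \<psi> M = M\<lparr>val := (val M)(p := {v \<in> worlds M. M, v \<Turnstile> \<psi>})\<rparr>"

lemma sat_Assign: "(M, w \<Turnstile> Assign p \<psi> \<phi>) \<longleftrightarrow> (update p \<psi> M, w \<Turnstile> \<phi>)"
  by (simp add: update_def)

lemma sat_Iter: "(M, w \<Turnstile> Iter p \<psi> \<phi>) \<longleftrightarrow> (\<exists>n. ((update p \<psi> ^^ n) M), w \<Turnstile> \<phi>)"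
  by (simp add: update_def[abs_def])

fun normal :: "'p fm \<Rightarrow> bool" where
  "normal (Letter p) \<longleftrightarrow> True"
| "normal (Neg \<phi>) \<longleftrightarrow> normal \<phi>"
| "normal (Conj \<phi> \<psi>) \<longleftrightarrow> normal \<phi> \<and> normal \<psi>"
| "normal (Dia \<phi>) \<longleftrightarrow> normal \<phi>"
| "normal (Assign p \<psi>\<^sub>0 (Iter q \<psi>\<^sub>1 \<phi>)) \<longleftrightarrow> q = p \<and> normal \<psi>\<^sub>0 \<and> normal \<psi>\<^sub>1 \<and> normal \<phi>"
| "normal (Assign p \<psi> \<phi>) \<longleftrightarrow> normal \<psi> \<and> normal \<phi>"
| "normal (Iter p \<psi> \<phi>) \<longleftrightarrow> False"

text \<open>
  \<open>occs B \<phi>\<close> collects the letter occurrences of \<open>\<phi>\<close>, each tagged \<open>True\<close> if it is bound and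
  \<open>False\<close> if it is free, where \<open>B\<close> is the set of pivots of the substitution operators in whose
  scope the position lies.  The body \<open>\<psi>\<close> is outside the scope of \<open>\<langle>p := \<psi>\<rangle>\<close> but inside the scope
  of \<open>\<langle>(p := \<psi>)*\<rangle>\<close>.
\<close>

primrec occs :: "'p set \<Rightarrow> 'p fm \<Rightarrow> ('p \<times> bool) set" where
  "occs B (Letter p) = {(p, p \<in> B)}"
| "occs B (Neg \<phi>) = occs B \<phi>"
| "occs B (Conj \<phi> \<psi>) = occs B \<phi> \<union> occs B \<psi>"
| "occs B (Dia \<phi>) = occs B \<phi>"
| "occs B (Assign p \<psi> \<phi>) = {(p, True)} \<union> occs B \<psi> \<union> occs (insert p B) \<phi>"
| "occs B (Iter p \<psi> \<phi>) = {(p, True)} \<union> occs (insert p B) \<psi> \<union> occs (insert p B) \<phi>"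

definition occurs_free :: "'p \<Rightarrow> 'p fm \<Rightarrow> bool" where
  "occurs_free p \<phi> \<longleftrightarrow> (p, False) \<in> occs {} \<phi>"

definition occurs_bound :: "'p \<Rightarrow> 'p fm \<Rightarrow> bool" where
  "occurs_bound p \<phi> \<longleftrightarrow> (p, True) \<in> occs {} \<phi>"

definition separated :: "'p fm \<Rightarrow> bool" where
  "separated \<phi> \<longleftrightarrow> normal \<phi> \<and> (\<forall>p. \<not> (occurs_free p \<phi> \<and> occurs_bound p \<phi>))"

text \<open>
  Cleanness is \<open>separated\<close> together with the convention that the constituents of a clean formula
  whose main connective is a substitution operator are clean.  Inheritance is imposed only there;
  requiring it below \<open>Neg\<close>, \<open>Conj\<close> and \<open>Dia\<close> as well would give a smaller class of formulas.
\<close>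

fun clean :: "'p fm \<Rightarrow> bool" where
  "clean (Assign p \<psi>\<^sub>0 (Iter q \<psi>\<^sub>1 \<phi>)) \<longleftrightarrow>
     separated (Assign p \<psi>\<^sub>0 (Iter q \<psi>\<^sub>1 \<phi>)) \<and> clean \<psi>\<^sub>0 \<and> clean \<psi>\<^sub>1 \<and> clean \<phi>"
| "clean (Assign p \<psi> \<phi>) \<longleftrightarrow> separated (Assign p \<psi> \<phi>) \<and> clean \<psi> \<and> clean \<phi>"
| "clean \<phi> \<longleftrightarrow> separated \<phi>"

text \<open>
  \<open>replace \<psi> p \<phi>\<close> is \<open>\<phi>[\<psi>/p]\<close>, meant for normal \<open>\<phi>\<close>.  A normal formula has \<open>Iter q\<close> only directly
  below an \<open>Assign q\<close>, so the separate clause for \<open>Iter\<close> just completes the clause for the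
  combination of the two, as the lemmas below confirm.
\<close>

primrec replace :: "'p fm \<Rightarrow> 'p \<Rightarrow> 'p fm \<Rightarrow> 'p fm" where
  "replace \<psi> p (Letter q) = (if q = p then \<psi> else Letter q)"
| "replace \<psi> p (Neg \<phi>) = Neg (replace \<psi> p \<phi>)"
| "replace \<psi> p (Conj \<phi> \<chi>) = Conj (replace \<psi> p \<phi>) (replace \<psi> p \<chi>)"
| "replace \<psi> p (Dia \<phi>) = Dia (replace \<psi> p \<phi>)"
| "replace \<psi> p (Assign q \<chi> \<phi>) =
     Assign q (replace \<psi> p \<chi>) (if q = p then \<phi> else replace \<psi> p \<phi>)"
| "replace \<psi> p (Iter q \<chi> \<phi>) =
     (if q = p then Iter q \<chi> \<phi> else Iter q (replace \<psi> p \<chi>) (replace \<psi> p \<phi>))"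

lemma replace_Assign_Iter:
  "q \<noteq> p \<Longrightarrow> replace \<psi> p (Assign q \<chi>\<^sub>0 (Iter q \<chi>\<^sub>1 \<phi>)) =
     Assign q (replace \<psi> p \<chi>\<^sub>0) (Iter q (replace \<psi> p \<chi>\<^sub>1) (replace \<psi> p \<phi>))"
  "replace \<psi> p (Assign p \<chi>\<^sub>0 (Iter p \<chi>\<^sub>1 \<phi>)) = Assign p (replace \<psi> p \<chi>\<^sub>0) (Iter p \<chi>\<^sub>1 \<phi>)"
  by simp_all

end

theory Submission imports Defs begin

text \<open>
  This is the substitution lemma of a language with binders.  Evaluating \<open>\<phi>\<close> after resetting \<open>p\<close>
  to the truth set of \<open>\<psi>\<close> agrees with evaluating \<open>\<phi>[\<psi>/p]\<close> in the original model as long as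
  wherever \<open>\<psi>\<close> is inserted it still means what it meant outside \<open>\<phi>\<close>.  Two things can go
  wrong: \<open>\<psi>\<close> may be inserted in the scope of an operator whose pivot influences \<open>\<psi>\<close>, and the
  replacement may stop at an operator \<open>\<langle>(p := \<chi>)*\<rangle>\<close> that still reads the incoming value of \<open>p\<close>
  (its zeroth iterate does).  The predicate \<open>free_for\<close> rules out both.

  Under \<open>free_for\<close> the heart of the induction is a commutation of model updates
  (\<open>update_commute\<close>): resetting \<open>p\<close> to \<open>\<psi>\<close> and then \<open>q\<close> to \<open>\<chi>\<close> has the same effect as resetting \<open>q\<close>
  to \<open>\<chi>[\<psi>/p]\<close> and then \<open>p\<close> to \<open>\<psi>\<close>, because the value of \<open>\<psi>\<close> does not depend on \<open>q\<close>.  Iterating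
  this equation settles the starred operators.

  Cleanness supplies \<open>free_for\<close> (\<open>free_for_if_normal\<close>).  Every pivot \<open>q\<close> of \<open>\<phi>\<close> is bound in
  \<open>\<langle>p := \<psi>\<rangle>\<phi>\<close>, so it is not free in \<open>\<psi>\<close>; and the truth of a normal formula depends only on its free
  letters.  Normality of \<open>\<phi>\<close> places every \<open>\<langle>(p := \<chi>)*\<rangle>\<close> directly below some \<open>\<langle>p := \<chi>\<^sub>0\<rangle>\<close>, where the
  incoming value of \<open>p\<close> has already been overwritten.
\<close>

section \<open>The letters on which the truth of a formula depends\<close>

text \<open>
  For normal formulas these are the free letters.  In general the pivot of a starred operator has
  to be included, although none of its occurrences is free, because the iteration starts from its
  current value; with it, coincidence holds by structural induction on arbitrary formulas.
\<close>

primrec deps :: "'p fm \<Rightarrow> 'p set" where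
  "deps (Letter p) = {p}"
| "deps (Neg \<phi>) = deps \<phi>"
| "deps (Conj \<phi> \<psi>) = deps \<phi> \<union> deps \<psi>"
| "deps (Dia \<phi>) = deps \<phi>"
| "deps (Assign p \<psi> \<phi>) = deps \<psi> \<union> (deps \<phi> - {p})"
| "deps (Iter p \<psi> \<phi>) = insert p (deps \<psi> \<union> deps \<phi>)"

definition agree_on :: "'p set \<Rightarrow> ('w, 'p) kripke \<Rightarrow> ('w, 'p) kripke \<Rightarrow> bool" where
  "agree_on S M N \<longleftrightarrow> worlds M = worlds N \<and> rel M = rel N \<and> (\<forall>q\<in>S. val M q = val N q)"

lemma agree_on_subset: "agree_on S M N \<Longrightarrow> T \<subseteq> S \<Longrightarrow> agree_on T M N"
  by (auto simp: agree_on_def)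

lemma worlds_update [simp]: "worlds (update p \<psi> M) = worlds M"
  and rel_update [simp]: "rel (update p \<psi> M) = rel M"
  by (simp_all add: update_def)

lemma val_update: "val (update p \<psi> M) = (val M)(p := {v \<in> worlds M. M, v \<Turnstile> \<psi>})"
  by (simp add: update_def)

declare holds.simps(5,6) [simp del]

lemma coincidence:
  fixes M N :: "('w, 'p) kripke"
  assumes "agree_on (deps \<phi>) M N"
  shows "(M, w \<Turnstile> \<phi>) \<longleftrightarrow> (N, w \<Turnstile> \<phi>)"
  using assms
proof (induction \<phi> arbitrary: M N w)
  case (Conj \<phi> \<chi>)
  then have "agree_on (deps \<phi>) M N" "agree_on (deps \<chi>) M N"
    by (auto simp: agree_on_def)
  then show ?case
    by (simp add: Conj.IH)
next
  case (Dia \<phi>)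
  have "(M, v \<Turnstile> \<phi>) \<longleftrightarrow> (N, v \<Turnstile> \<phi>)" for v
    using Dia.prems by (intro Dia.IH) simp
  then show ?case
    using Dia.prems by (simp add: agree_on_def)
next
  case (Assign p \<psi> \<phi>)
  have "(M, v \<Turnstile> \<psi>) \<longleftrightarrow> (N, v \<Turnstile> \<psi>)" for v
    by (rule Assign.IH(1), rule agree_on_subset[OF Assign.prems]) simp
  then have "agree_on (deps \<phi>) (update p \<psi> M) (update p \<psi> N)"
    using Assign.prems by (auto simp: agree_on_def val_update)
  then show ?case
    by (simp add: sat_Assign Assign.IH(2))
next
  case (Iter p \<psi> \<phi>)
  let ?S = "deps (Iter p \<psi> \<phi>)"
  have step: "agree_on ?S (update p \<psi> M') (update p \<psi> N')" if "agree_on ?S M' N'"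
    for M' N' :: "('w, 'p) kripke"
  proof -
    have "(M', v \<Turnstile> \<psi>) \<longleftrightarrow> (N', v \<Turnstile> \<psi>)" for v
      by (rule Iter.IH(1), rule agree_on_subset[OF that]) auto
    then show ?thesis
      using that by (auto simp: agree_on_def val_update)
  qed
  have iterates: "agree_on ?S ((update p \<psi> ^^ n) M) ((update p \<psi> ^^ n) N)" for n
    by (induction n) (use Iter.prems step in simp_all)
  have "((update p \<psi> ^^ n) M, w \<Turnstile> \<phi>) \<longleftrightarrow> ((update p \<psi> ^^ n) N, w \<Turnstile> \<phi>)" for n
    by (rule Iter.IH(2), rule agree_on_subset[OF iterates]) auto
  then show ?case
    by (simp add: sat_Iter)
qed (auto simp: agree_on_def)

text \<open>
  The context \<open>B\<close> of \<open>occs\<close> grows below an operator, so it has to be arbitrary in the induction.  In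
  a normal formula the pivot that a starred operator contributes to \<open>deps\<close> is removed again by the
  single-step operator just above.
\<close>

lemma deps_occur_free:
  "normal \<phi> \<Longrightarrow> q \<in> deps \<phi> \<Longrightarrow> q \<notin> B \<Longrightarrow> (q, False) \<in> occs B \<phi>"
  by (induction \<phi> arbitrary: B rule: normal.induct) (simp_all, blast+)

section \<open>The substitution lemma\<close>

text \<open>
  The usual condition that \<open>\<psi>\<close> is substitutable for \<open>p\<close> without capture.  In the scope of \<open>\<langle>p := \<chi>\<rangle>\<close> nothing
  is demanded, since neither the replacement nor the incoming value of \<open>p\<close> gets past that operator.
  A starred operator with pivot \<open>p\<close> that is reached otherwise is rejected.
\<close>

primrec free_for :: "'p fm \<Rightarrow> 'p \<Rightarrow> 'p fm \<Rightarrow> bool" where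
  "free_for \<psi> p (Letter q) \<longleftrightarrow> True"
| "free_for \<psi> p (Neg \<phi>) \<longleftrightarrow> free_for \<psi> p \<phi>"
| "free_for \<psi> p (Conj \<phi> \<chi>) \<longleftrightarrow> free_for \<psi> p \<phi> \<and> free_for \<psi> p \<chi>"
| "free_for \<psi> p (Dia \<phi>) \<longleftrightarrow> free_for \<psi> p \<phi>"
| "free_for \<psi> p (Assign q \<chi> \<phi>) \<longleftrightarrow>
     free_for \<psi> p \<chi> \<and> (q = p \<or> q \<notin> deps \<psi> \<and> free_for \<psi> p \<phi>)"
| "free_for \<psi> p (Iter q \<chi> \<phi>) \<longleftrightarrow>
     q \<noteq> p \<and> q \<notin> deps \<psi> \<and> free_for \<psi> p \<chi> \<and> free_for \<psi> p \<phi>"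

lemma update_overwrite:
  assumes "\<And>v. v \<in> worlds N \<Longrightarrow> (update p \<psi> N, v \<Turnstile> \<chi>) \<longleftrightarrow> (N, v \<Turnstile> \<chi>')"
  shows "update p \<chi> (update p \<psi> N) = update p \<chi>' N"
  using assms by (intro kripke.equality) (auto simp: val_update fun_eq_iff)

text \<open>
  Changing \<open>q\<close> leaves the truth set of \<open>\<psi>\<close> alone by coincidence, and the two truth sets assigned
  to \<open>q\<close> are equal by hypothesis; what remains is that changes at distinct letters commute.
\<close>

lemma update_commute:
  assumes "q \<noteq> p" and "q \<notin> deps \<psi>"
    and "\<And>v. v \<in> worlds N \<Longrightarrow> (update p \<psi> N, v \<Turnstile> \<chi>) \<longleftrightarrow> (N, v \<Turnstile> \<chi>')"
  shows "update q \<chi> (update p \<psi> N) = update p \<psi> (update q \<chi>' N)"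
proof -
  have "agree_on (deps \<psi>) (update q \<chi>' N) N"
    using assms(2) by (auto simp: agree_on_def val_update)
  then have "(update q \<chi>' N, v \<Turnstile> \<psi>) \<longleftrightarrow> (N, v \<Turnstile> \<psi>)" for v
    by (rule coincidence)
  then have "val (update q \<chi> (update p \<psi> N)) = val (update p \<psi> (update q \<chi>' N))"
    using assms(1,3) by (auto simp: val_update fun_eq_iff)
  then show ?thesis
    by (intro kripke.equality) simp_all
qed

text \<open>
  Truth sets are cut down to the worlds of the model, so equivalence at a point needs the point to
  be a world, and the accessibility relation must not lead out of the worlds.  The model is
  arbitrary in the induction because the operators change it.
\<close>

lemma substitution:
  assumes "free_for \<psi> p \<phi>" and "Range (rel N) \<subseteq> worlds N" and "w \<in> worlds N"
  shows "(update p \<psi> N, w \<Turnstile> \<phi>) \<longleftrightarrow> (N, w \<Turnstile> replace \<psi> p \<phi>)"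
  using assms
proof (induction \<phi> arbitrary: N w)
  case (Letter q)
  then show ?case by (simp add: val_update)
next
  case (Dia \<phi>)
  then have "(update p \<psi> N, v \<Turnstile> \<phi>) \<longleftrightarrow> (N, v \<Turnstile> replace \<psi> p \<phi>)" if "(w, v) \<in> rel N" for v
    using that by (intro Dia.IH) auto
  then show ?case by auto
next
  case (Assign q \<chi> \<phi>)
  have \<chi>: "(update p \<psi> N, v \<Turnstile> \<chi>) \<longleftrightarrow> (N, v \<Turnstile> replace \<psi> p \<chi>)" if "v \<in> worlds N" for v
    using Assign.prems that by (intro Assign.IH(1)) auto
  show ?case
  proof (cases "q = p")
    case True
    then show ?thesis
      using update_overwrite[OF \<chi>] by (simp add: sat_Assign)
  next
    case False
    then have "q \<notin> deps \<psi>" and "free_for \<psi> p \<phi>"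
      using Assign.prems(1) by auto
    then show ?thesis
      using False Assign.prems(2,3) update_commute[OF False _ \<chi>] by (simp add: sat_Assign Assign.IH(2))
  qed
next
  case (Iter q \<chi> \<phi>)
  let ?\<chi> = "replace \<psi> p \<chi>"
  have q: "q \<noteq> p" "q \<notin> deps \<psi>" and ff: "free_for \<psi> p \<chi>" "free_for \<psi> p \<phi>"
    using Iter.prems(1) by auto
  have frame: "worlds ((update q ?\<chi> ^^ n) N) = worlds N" "rel ((update q ?\<chi> ^^ n) N) = rel N" for n
    by (induction n) simp_all
  have "(update q \<chi> ^^ n) (update p \<psi> N) = update p \<psi> ((update q ?\<chi> ^^ n) N)" for n
  proof (induction n)
    case (Suc n)
    let ?N = "(update q ?\<chi> ^^ n) N"
    have "update q \<chi> (update p \<psi> ?N) = update p \<psi> (update q ?\<chi> ?N)"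
      using q ff(1) Iter.prems(2) by (intro update_commute Iter.IH(1)) (auto simp: frame)
    with Suc show ?case by simp
  qed simp
  moreover have "(update p \<psi> ((update q ?\<chi> ^^ n) N), w \<Turnstile> \<phi>)
      \<longleftrightarrow> ((update q ?\<chi> ^^ n) N, w \<Turnstile> replace \<psi> p \<phi>)" for n
    using ff(2) Iter.prems(2,3) by (intro Iter.IH(2)) (simp_all add: frame)
  ultimately show ?case
    using q(1) by (simp add: sat_Iter)
qed simp_all

section \<open>Clean formulas\<close>

lemma clean_normal: "clean \<phi> \<Longrightarrow> normal \<phi>"
  by (cases \<phi> rule: clean.cases) (auto simp: separated_def)

text \<open>
  Normality is what excludes a starred operator with pivot \<open>p\<close> at a position that the replacement
  reaches: such an operator sits directly below a single-step operator with the same pivot.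
\<close>

lemma free_for_if_normal:
  assumes "normal \<phi>" and "\<And>q. (q, True) \<in> occs B \<phi> \<Longrightarrow> q \<notin> deps \<psi>"
  shows "free_for \<psi> p \<phi>"
  using assms by (induction \<phi> arbitrary: B rule: normal.induct) fastforce+

theorem theorem4p6:
  fixes p :: "'p::countable" and \<psi> \<phi> :: "'p fm"
    and M :: "('w, 'p) kripke" and w :: 'w
  assumes "clean (Assign p \<psi> \<phi>)" and "clean \<phi>"
    and "kripke_model M" and "w \<in> worlds M"
  shows "(M, w \<Turnstile> Assign p \<psi> \<phi>) \<longleftrightarrow> (M, w \<Turnstile> replace \<psi> p \<phi>)"
proof -
  have sep: "separated (Assign p \<psi> \<phi>)"
    using assms(1) by (cases \<phi>) auto
  then have "normal \<psi>"
    by (cases \<phi>) (auto simp: separated_def)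
  have "q \<notin> deps \<psi>" if "(q, True) \<in> occs {p} \<phi>" for q
  proof
    assume "q \<in> deps \<psi>"
    with \<open>normal \<psi>\<close> have "(q, False) \<in> occs {} \<psi>"
      by (simp add: deps_occur_free)
    with that sep show False
      by (auto simp: separated_def occurs_free_def occurs_bound_def)
  qed
  with clean_normal[OF assms(2)] have "free_for \<psi> p \<phi>"
    by (rule free_for_if_normal)
  moreover have "Range (rel M) \<subseteq> worlds M"
    using assms(3) by (auto simp: kripke_model_def)
  ultimately show ?thesis
    using substitution assms(4) by (simp add: sat_Assign)
qed

end
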